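(* Let $A\in\mathbb R^{m\times N}$ and $\mathcal P\subseteq\mathbb R^N$ satisfy the standing assumptions in the context, and let $K<N$ be a positive integer. Let $0\ne z\in\Sigma_K\cap\mathcal P$ with $|\mathrm{supp}(z)|=r$. Then the exact support recovery of $z$ is achieved via constrained matching pursuit if and only if for any sequence $\big((x^k,j^*_k,\mathcal J_k)\big)_{k\in\mathbb N}$ generated by constrained matching pursuit with $y=Az$, the following holds: $$\min_{j\in\mathrm{supp}(z)\setminus\mathcal J_k} f^*_j(z,x^k)\;<\;\min_{j\in[\mathrm{supp}(z)]^c} f^*_j(z,x^k),\qquad \forall\,k=0,1,\ldots,r-1.$$ Moreover, when the exact support recovery of $z$ is achieved, the support of $z$ is first attained at the $r$th step along any such sequence, i.e., $\mathcal J_r=\mathrm{supp}(z)$ and $\mathcal J_k\subsetneq\mathrm{supp}(z)$ for each $k<r$.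
   Context: Notation: $A_{\bullet j}$ is the $j$th column of $A$; $\mathbf e_j$ is the $j$th standard basis vector of $\mathbb R^N$; $\mathrm{supp}(x)=\{i: x_i\ne 0\}$; $\Sigma_K=\{x\in\mathbb R^N: |\mathrm{supp}(x)|\le K\}$; $S^c$ is the complement of $S$ in $\{1,\dots,N\}$. Standing assumptions: every column of $A$ is nonzero; $\mathcal P$ is a closed (possibly nonconvex) set with $0\in\mathcal P$; and for the vector $y=Az$ and every index set $\mathcal J\subseteq\{1,\dots,N\}$, the problem $\min\{\|Aw-y\|_2^2 : w\in\mathcal P,\ \mathrm{supp}(w)\subseteq\mathcal J\}$ attains a solution. For $u,v\in\mathcal P$ and $j\in\{1,\dots,N\}$: $f^*_j(u,v):=\min\{\|Au-A(v+t\mathbf e_j)\|_2^2 : t\in\mathbb R,\ v+t\mathbf e_j\in\mathcal P\}$. Constrained matching pursuit with input $y$: set $x^0=0$, $\mathcal J_0=\emptyset$. For $k=0,1,2,\dots$ (indefinitely): let $g^*_j=\min\{\|y-A(x^k+t\mathbf e_j)\|_2^2: t\in\mathbb R,\ x^k+t\mathbf e_j\in\mathcal P\}$ for each $j\in\{1,\dots,N\}$; choose any $j^*_{k+1}$ minimizing $g^*_j$ over $j\in\{1,\dots,N\}$; set $\mathcal J_{k+1}=\mathcal J_k\cup\{j^*_{k+1}\}$; choose any $x^{k+1}$ minimizing $\|Aw-y\|_2^2$ over $w\in\mathcal P$ with $\mathrm{supp}(w)\subseteq\mathcal J_{k+1}$. Because choices may be non-unique, several sequences $((x^k,j^*_k,\mathcal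 J_k))_k$ may be generated from the same $y$. Exact support recovery of $z$ is achieved if along every sequence generated with $y=Az$ there exists an index $s$ with $\mathcal J_s=\mathrm{supp}(z)$. *)

theory Defs
  imports "HOL-Analysis.Analysis"
begin

definition supp :: "real ^ 'n \<Rightarrow> 'n set" where
  "supp x = {i. x $ i \<noteq> 0}"

definition sparse_vectors :: "nat \<Rightarrow> (real ^ 'n) set" where
  "sparse_vectors K = {x. card (supp x) \<le> K}"

definition restricted_minimizer ::
  "real ^ 'n ^ 'm \<Rightarrow> (real ^ 'n) set \<Rightarrow> real ^ 'm \<Rightarrow> 'n set \<Rightarrow> real ^ 'n \<Rightarrow> bool" where
  "restricted_minimizer A P y J w \<longleftrightarrow>
     is_arg_min (\<lambda>w. (norm (A *v w - y))\<^sup>2) (\<lambda>w. w \<in> P \<and> supp w \<subseteq> J) w"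

(* The minima over t in f_star and g_star are written as infima. They are attained whenever P is
   closed, v (resp. x) lies in P and column j of A is nonzero; see f_star_attained, g_star_attained. *)

definition f_star ::
  "real ^ 'n ^ 'm \<Rightarrow> (real ^ 'n) set \<Rightarrow> 'n \<Rightarrow> real ^ 'n \<Rightarrow> real ^ 'n \<Rightarrow> real" where
  "f_star A P j u v =
     (INF t \<in> {t. v + t *\<^sub>R axis j 1 \<in> P}. (norm (A *v u - A *v (v + t *\<^sub>R axis j 1)))\<^sup>2)"

definition g_star ::
  "real ^ 'n ^ 'm \<Rightarrow> (real ^ 'n) set \<Rightarrow> real ^ 'm \<Rightarrow> real ^ 'n \<Rightarrow> 'n \<Rightarrow> real" where
  "g_star A P y x j =
     (INF t \<in> {t. x + t *\<^sub>R axis j 1 \<in> P}. (norm (y - A *v (x + t *\<^sub>R axis j 1)))\<^sup>2)"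

(* The index selected in step k + 1 is js (Suc k); the value js 0 is unconstrained and never used. *)

definition cmp_sequence ::
  "real ^ 'n ^ 'm \<Rightarrow> (real ^ 'n) set \<Rightarrow> real ^ 'm \<Rightarrow>
   (nat \<Rightarrow> real ^ 'n) \<Rightarrow> (nat \<Rightarrow> 'n) \<Rightarrow> (nat \<Rightarrow> 'n set) \<Rightarrow> bool" where
  "cmp_sequence A P y x js J \<longleftrightarrow>
     x 0 = 0 \<and> J 0 = {} \<and>
     (\<forall>k. is_arg_min (g_star A P y (x k)) (\<lambda>j. True) (js (Suc k)) \<and>
          J (Suc k) = J k \<union> {js (Suc k)} \<and>
          restricted_minimizer A P y (J (Suc k)) (x (Suc k)))"

definition exact_support_recovery ::
  "real ^ 'n ^ 'm \<Rightarrow> (real ^ 'n) set \<Rightarrow> real ^ 'n \<Rightarrow> bool" where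
  "exact_support_recovery A P z \<longleftrightarrow>
     (\<forall>x js J. cmp_sequence A P (A *v z) x js J \<longrightarrow> (\<exists>s. J s = supp z))"

lemma g_star_attained:
  fixes A :: "real ^ 'n ^ 'm"
  assumes "closed P" "x \<in> P" "column j A \<noteq> 0"
  shows "\<exists>t. x + t *\<^sub>R axis j 1 \<in> P \<and>
             g_star A P y x j = (norm (y - A *v (x + t *\<^sub>R axis j 1)))\<^sup>2 \<and>
             (\<forall>s. x + s *\<^sub>R axis j 1 \<in> P \<longrightarrow>
                g_star A P y x j \<le> (norm (y - A *v (x + s *\<^sub>R axis j 1)))\<^sup>2)"
proof -
  define a where "a = column j A"
  define T where "T = {t. x + t *\<^sub>R axis j 1 \<in> P}"
  define q where "q = (\<lambda>t. (norm (y - A *v (x + t *\<^sub>R axis j 1)))\<^sup>2)"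
  have Aej: "A *v axis j 1 = a"
    by (simp add: a_def matrix_vector_mult_basis)
  have q: "q t = (dist (y - A *v x) (t *\<^sub>R a))\<^sup>2" for t
    by (simp add: q_def dist_norm matrix_vector_right_distrib matrix_vector_mult_scaleR Aej
        diff_diff_add)
  have "T = (\<lambda>t. x + t *\<^sub>R axis j 1) -` P" by (auto simp: T_def)
  then have "closed T"
    using assms(1)
    by (auto intro!: closed_vimage continuous_on_add continuous_on_scaleR continuous_on_const continuous_on_id)
  then have cl: "closed ((\<lambda>t. t *\<^sub>R a) ` T)"
  proof (rule closed_injective_linear_image)
    show "linear (\<lambda>t. t *\<^sub>R a)"
      by (simp add: linear_iff scaleR_left_distrib)
    show "inj (\<lambda>t. t *\<^sub>R a)"
      using assms(3) by (simp add: a_def inj_on_def)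
  qed
  have "0 \<in> T" using assms(2) by (simp add: T_def)
  then have ne: "(\<lambda>t. t *\<^sub>R a) ` T \<noteq> {}" by blast
  obtain b where b: "b \<in> (\<lambda>t. t *\<^sub>R a) ` T"
      "\<And>c. c \<in> (\<lambda>t. t *\<^sub>R a) ` T \<Longrightarrow> dist (y - A *v x) b \<le> dist (y - A *v x) c"
    using distance_attains_inf[OF cl ne] by metis
  from b(1) obtain t where t: "t \<in> T" "b = t *\<^sub>R a" by blast
  have min: "q t \<le> q s" if "s \<in> T" for s
    unfolding q using b(2)[OF imageI[OF that]] t(2) by (simp add: power_mono)
  have "g_star A P y x j = (INF t \<in> T. q t)"
    by (simp add: g_star_def T_def q_def)
  also have "\<dots> = q t"
    using t(1) min by (intro cInf_eq_minimum) auto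
  finally show ?thesis
    using t(1) min unfolding T_def q_def by auto
qed

lemma f_star_attained:
  fixes A :: "real ^ 'n ^ 'm"
  assumes "closed P" "v \<in> P" "column j A \<noteq> 0"
  shows "\<exists>t. v + t *\<^sub>R axis j 1 \<in> P \<and>
             f_star A P j u v = (norm (A *v u - A *v (v + t *\<^sub>R axis j 1)))\<^sup>2 \<and>
             (\<forall>s. v + s *\<^sub>R axis j 1 \<in> P \<longrightarrow>
                f_star A P j u v \<le> (norm (A *v u - A *v (v + s *\<^sub>R axis j 1)))\<^sup>2)"
  using g_star_attained[OF assms, of "A *v u"] by (simp add: f_star_def g_star_def)

end

theory Submission
  imports Defs
begin

text \<open>
  The residual \<open>norm (A *v x k - y)\<close> squared bounds every \<open>g_star\<close> value from above, with equality
  for indices already in \<open>J k\<close>, because \<open>x k\<close> is optimal on \<open>J k\<close>. Hence the strict inequality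
  forces a new index of \<open>supp z\<close> at each of the first \<open>r\<close> steps. Conversely, if it fails at some
  step \<open>k < r\<close>, then some index outside \<open>supp z\<close> minimises \<open>g_star\<close> globally; selecting it
  gives a sequence that misses \<open>supp z\<close>, since \<open>J k\<close> has fewer than \<open>r\<close> elements and later
  index sets all contain the wrong index.
\<close>

text \<open>With \<open>y = A *v z\<close>, the quantities compared in the theorem are exactly the
  scores by which the algorithm selects its next index.\<close>

lemma f_star_eq_g_star: "f_star A P j u v = g_star A P (A *v u) v j"
  by (simp add: f_star_def g_star_def)

lemma g_star_le_residual:
  assumes "x \<in> P"
  shows "g_star A P y x j \<le> (norm (A *v x - y))\<^sup>2"
proof -
  have "g_star A P y x j \<le> (norm (y - A *v (x + 0 *\<^sub>R axis j 1)))\<^sup>2"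
    unfolding g_star_def using assms
    by (intro cINF_lower bdd_belowI[of _ 0]) auto
  then show ?thesis by (simp add: norm_minus_commute)
qed

lemma g_star_eq_residual:
  assumes "restricted_minimizer A P y J x" "j \<in> J"
  shows "g_star A P y x j = (norm (A *v x - y))\<^sup>2"
proof (rule antisym)
  have x: "x \<in> P" "supp x \<subseteq> J"
    and opt: "\<And>w. w \<in> P \<Longrightarrow> supp w \<subseteq> J \<Longrightarrow> (norm (A *v x - y))\<^sup>2 \<le> (norm (A *v w - y))\<^sup>2"
    using assms(1) by (auto simp: restricted_minimizer_def is_arg_min_linorder)
  show "g_star A P y x j \<le> (norm (A *v x - y))\<^sup>2"
    using x(1) by (rule g_star_le_residual)
  \<comment> \<open>Moving along an axis in \<open>J\<close> keeps the support inside
    \<open>J\<close>, so every admissible \<open>t\<close> yields a competitor in the restricted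
    problem that \<open>x\<close> already solves.\<close>
  have "supp (x + t *\<^sub>R axis j 1) \<subseteq> J" for t
    using x(2) assms(2) by (auto simp: supp_def axis_def split: if_splits)
  moreover have "0 \<in> {t. x + t *\<^sub>R axis j 1 \<in> P}" using x(1) by simp
  ultimately show "(norm (A *v x - y))\<^sup>2 \<le> g_star A P y x j"
    unfolding g_star_def norm_minus_commute[of y]
    by (intro cINF_greatest) (use opt in blast)+
qed

text \<open>The start \<open>x 0 = 0\<close> is prescribed rather than obtained by minimisation.
  Since 0 is the only vector with empty support, optimality on \<open>J k\<close> nevertheless holds
  from \<open>k = 0\<close> on.\<close>

lemma restricted_minimizer_empty:
  fixes A :: "real ^ 'n ^ 'm"
  assumes "0 \<in> P"
  shows "restricted_minimizer A P y {} 0"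
proof -
  have "supp w \<subseteq> {} \<longleftrightarrow> w = 0" for w :: "real ^ 'n"
    by (auto simp: supp_def vec_eq_iff)
  then show ?thesis
    using assms by (auto simp: restricted_minimizer_def is_arg_min_linorder)
qed

lemma ex_is_arg_min_finite:
  fixes f :: "'a::finite \<Rightarrow> 'b::linorder"
  shows "\<exists>i. is_arg_min f (\<lambda>i. True) i"
  using ex_is_arg_min_if_finite[of "UNIV :: 'a set" f] by simp

lemma cmp_sequence_step:
  assumes "cmp_sequence A P y x js J"
  shows "is_arg_min (g_star A P y (x k)) (\<lambda>j. True) (js (Suc k))"
    and "J (Suc k) = insert (js (Suc k)) (J k)"
    and "restricted_minimizer A P y (J (Suc k)) (x (Suc k))"
  using assms unfolding cmp_sequence_def by blast+

lemma cmp_sequence_minimizer: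
  assumes "cmp_sequence A P y x js J" "0 \<in> P"
  shows "restricted_minimizer A P y (J k) (x k)"
proof (cases k)
  case 0
  then show ?thesis
    using assms restricted_minimizer_empty by (simp add: cmp_sequence_def)
next
  case (Suc n)
  then show ?thesis using cmp_sequence_step(3)[OF assms(1)] by simp
qed

lemma cmp_sequence_mono:
  assumes "cmp_sequence A P y x js J" "k \<le> l"
  shows "J k \<subseteq> J l"
proof (rule lift_Suc_mono_le[OF _ assms(2)])
  show "J n \<subseteq> J (Suc n)" for n using cmp_sequence_step(2)[OF assms(1), of n] by blast
qed

text \<open>Only an inequality in general, because an index may be selected again.\<close>

lemma cmp_sequence_card_le:
  assumes "cmp_sequence A P y x js J"
  shows "card (J k) \<le> k"
proof (induction k)
  case 0
  show ?case using assms by (simp add: cmp_sequence_def)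
next
  case (Suc k)
  then show ?case
    using cmp_sequence_step(2)[OF assms, of k] by (simp add: card_insert_if)
qed

text \<open>Recovery quantifies over all runs, so a bad choice at one step must be extended to an
  infinite run: copy the given run up to \<open>k\<close>, select \<open>j\<close>, then continue
  with arbitrary legal choices.\<close>

lemma cmp_sequence_redirect:
  fixes A :: "real ^ 'n ^ 'm"
  assumes seq: "cmp_sequence A P y x js J"
    and ex: "\<And>J. \<exists>w. restricted_minimizer A P y J w"
    and j: "is_arg_min (g_star A P y (x k)) (\<lambda>j. True) j"
  obtains x' js' J' where "cmp_sequence A P y x' js' J'"
    and "\<And>i. i \<le> k \<Longrightarrow> J' i = J i" and "js' (Suc k) = j"
proof -
  \<comment> \<open>States are triples of iterate, selected index and index set. \<open>?I\<close>
    pins them to the old run up to time \<open>k\<close> and is vacuous afterwards;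
    \<open>?R\<close> is one step of the algorithm, with the selection forced when
    \<open>n = k\<close>.\<close>
  let ?I = "\<lambda>n s. n \<le> k \<longrightarrow> s = (x n, js n, J n)"
  let ?R = "\<lambda>n (v, _, I) (v', i', I').
    is_arg_min (g_star A P y v) (\<lambda>j. True) i' \<and> I' = I \<union> {i'} \<and>
    restricted_minimizer A P y I' v' \<and> (n = k \<longrightarrow> i' = j)"
  have "\<exists>s'. ?I (Suc n) s' \<and> ?R n s s'" if I: "?I n s" for n s
  proof (cases "n < k")
    case True
    then show ?thesis
      using I cmp_sequence_step[OF seq, of n]
      by (intro exI[of _ "(x (Suc n), js (Suc n), J (Suc n))"]) auto
  next
    case False
    obtain v i I' where s: "s = (v, i, I')" by (cases s)
    obtain i' where i': "is_arg_min (g_star A P y v) (\<lambda>j. True) i'" "n = k \<longrightarrow> i' = j"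
    proof (cases "n = k")
      case True
      \<comment> \<open>Here \<open>?I\<close> identifies \<open>v\<close> with \<open>x k\<close>,
        for which \<open>j\<close> is a minimiser by assumption, so forcing it is legal.\<close>
      then show ?thesis using that[of j] I s j by simp
    next
      case False
      then show ?thesis
        using that ex_is_arg_min_finite[of "g_star A P y v"] by blast
    qed
    obtain w where "restricted_minimizer A P y (I' \<union> {i'}) w" using ex by blast
    then show ?thesis
      using False i' s by (intro exI[of _ "(w, i', I' \<union> {i'})"]) auto
  qed
  moreover have "\<exists>s. ?I 0 s" by blast
  ultimately have "\<exists>s. \<forall>n. ?I n (s n) \<and> ?R n (s n) (s (Suc n))"
    by (intro dependent_nat_choice)
  then obtain s where s: "\<forall>n. ?I n (s n) \<and> ?R n (s n) (s (Suc n))" ..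
  note I = conjunct1[OF spec[OF s]] and R = conjunct2[OF spec[OF s]]
  define x' js' J' where defs: "x' = (\<lambda>n. fst (s n))" "js' = (\<lambda>n. fst (snd (s n)))"
    "J' = (\<lambda>n. snd (snd (s n)))"
  have R': "is_arg_min (g_star A P y (x' n)) (\<lambda>j. True) (js' (Suc n)) \<and>
      J' (Suc n) = J' n \<union> {js' (Suc n)} \<and>
      restricted_minimizer A P y (J' (Suc n)) (x' (Suc n)) \<and> (n = k \<longrightarrow> js' (Suc n) = j)" for n
    using R[of n] unfolding defs case_prod_beta .
  show thesis
  proof
    show "cmp_sequence A P y x' js' J'"
      unfolding cmp_sequence_def
    proof (intro conjI allI)
      show "x' 0 = 0" "J' 0 = {}"
        using seq I[of 0] by (simp_all add: cmp_sequence_def defs)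
    qed (use R' in blast)+
    show "J' i = J i" if "i \<le> k" for i
      using I[of i] that by (simp add: defs)
    show "js' (Suc k) = j"
      using R'[of k] by blast
  qed
qed

text \<open>Indices outside \<open>S\<close> score above the best one in \<open>S - J k\<close>, yet
  at most the residual. Those in \<open>J k\<close> score exactly the residual, so they lose as
  well; \<open>S \<noteq> UNIV\<close> supplies the outside index that links the two bounds.\<close>

lemma selected_index_new:
  fixes A :: "real ^ 'n ^ 'm"
  assumes seq: "cmp_sequence A P y x js J" and "0 \<in> P"
    and ne: "S - J k \<noteq> {}" and S: "S \<noteq> UNIV"
    and less: "Min (g_star A P y (x k) ` (S - J k)) < Min (g_star A P y (x k) ` (- S))"
  shows "js (Suc k) \<in> S - J k"
proof -
  let ?g = "g_star A P y (x k)"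
  have rm: "restricted_minimizer A P y (J k) (x k)"
    using seq \<open>0 \<in> P\<close> by (rule cmp_sequence_minimizer)
  then have P: "x k \<in> P" by (simp add: restricted_minimizer_def is_arg_min_linorder)
  have "Min (?g ` (S - J k)) \<in> ?g ` (S - J k)" using ne by (intro Min_in) auto
  then obtain i where i: "?g i = Min (?g ` (S - J k))" by auto
  have out: "?g i < ?g j" if "j \<in> - S" for j
  proof -
    have "Min (?g ` (- S)) \<le> ?g j" using that by simp
    then show ?thesis using less i by linarith
  qed
  obtain l where "l \<in> - S" using S by blast
  then have "?g i < (norm (A *v x k - y))\<^sup>2"
    using less_le_trans[OF out g_star_le_residual[OF P]] by blast
  then have old: "?g i < ?g j" if "j \<in> J k" for j
    using g_star_eq_residual[OF rm that] by simp
  have "?g (js (Suc k)) \<le> ?g i"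
    using cmp_sequence_step(1)[OF seq, of k] by (simp add: is_arg_min_linorder)
  then show ?thesis using out old by (meson ComplI DiffI not_le)
qed

text \<open>The best index outside \<open>S\<close> ties or beats \<open>S - J k\<close> by the
  failed inequality, and \<open>J k\<close> because scores there equal the residual, an upper bound
  for all scores.\<close>

lemma wrong_index_selectable:
  fixes A :: "real ^ 'n ^ 'm"
  assumes seq: "cmp_sequence A P y x js J" and "0 \<in> P"
    and ne: "S - J k \<noteq> {}" and S: "S \<noteq> UNIV"
    and not_less: "\<not> Min (g_star A P y (x k) ` (S - J k)) < Min (g_star A P y (x k) ` (- S))"
  obtains j where "j \<notin> S" "is_arg_min (g_star A P y (x k)) (\<lambda>j. True) j"
proof -
  let ?g = "g_star A P y (x k)"
  have rm: "restricted_minimizer A P y (J k) (x k)"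
    using seq \<open>0 \<in> P\<close> by (rule cmp_sequence_minimizer)
  then have P: "x k \<in> P" by (simp add: restricted_minimizer_def is_arg_min_linorder)
  have "Min (?g ` (- S)) \<in> ?g ` (- S)" using S by (intro Min_in) auto
  then obtain j where j: "j \<notin> S" "?g j = Min (?g ` (- S))" by auto
  have "?g j \<le> ?g i" for i
  proof -
    consider "i \<in> - S" | "i \<in> S - J k" | "i \<in> J k" by blast
    then show ?thesis
    proof cases
      case 1
      then show ?thesis using j(2) by simp
    next
      case 2
      then have "Min (?g ` (S - J k)) \<le> ?g i" by simp
      then show ?thesis using not_less j(2) by linarith
    next
      case 3
      then show ?thesis
        using g_star_eq_residual[OF rm] g_star_le_residual[OF P] by simp
    qed
  qed
  then show thesis using j(1) by (intro that) (auto simp: is_arg_min_linorder)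
qed

lemma cmp_sequence_card_eq:
  fixes A :: "real ^ 'n ^ 'm"
  assumes seq: "cmp_sequence A P y x js J" and "0 \<in> P" and S: "S \<noteq> UNIV"
    and less: "\<And>k. k < card S \<Longrightarrow>
      Min (g_star A P y (x k) ` (S - J k)) < Min (g_star A P y (x k) ` (- S))"
    and "k \<le> card S"
  shows "J k \<subseteq> S \<and> card (J k) = k"
  using \<open>k \<le> card S\<close>
proof (induction k)
  case 0
  show ?case using seq by (simp add: cmp_sequence_def)
next
  case (Suc k)
  then have IH: "J k \<subseteq> S" "card (J k) = k" and k: "k < card S" by auto
  \<comment> \<open>The exact count in the induction hypothesis is what keeps this set nonempty, so
    that its \<open>Min\<close> is a genuine score.\<close>
  then have "S - J k \<noteq> {}" by auto
  from selected_index_new[OF seq \<open>0 \<in> P\<close> this S less[OF k]]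
  show ?case using IH cmp_sequence_step(2)[OF seq, of k] by simp
qed

theorem theorem3p1:
  fixes A :: "real ^ 'n ^ 'm" and P :: "(real ^ 'n) set" and z :: "real ^ 'n" and K r :: nat
  assumes "\<And>j. column j A \<noteq> 0"
    and "closed P" and "0 \<in> P"
    and "\<And>J. \<exists>w. restricted_minimizer A P (A *v z) J w"
    and "0 < K" and "K < CARD('n)"
    and "z \<noteq> 0" and "z \<in> sparse_vectors K \<inter> P" and "card (supp z) = r"
  shows "(exact_support_recovery A P z \<longleftrightarrow>
            (\<forall>x js J. cmp_sequence A P (A *v z) x js J \<longrightarrow>
               (\<forall>k<r. Min ((\<lambda>j. f_star A P j z (x k)) ` (supp z - J k))
                      < Min ((\<lambda>j. f_star A P j z (x k)) ` (- supp z))))) \<and>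
         (exact_support_recovery A P z \<longrightarrow>
            (\<forall>x js J. cmp_sequence A P (A *v z) x js J \<longrightarrow>
               J r = supp z \<and> (\<forall>k<r. J k \<subset> supp z)))"
proof -
  let ?S = "supp z" and ?y = "A *v z"
  let ?less = "\<lambda>x J k. Min (g_star A P ?y (x k) ` (?S - J k)) < Min (g_star A P ?y (x k) ` (- ?S))"
  note P0 = \<open>0 \<in> P\<close> and r = \<open>card ?S = r\<close>
  \<comment> \<open>Sparsity with \<open>K < CARD('n)\<close> leaves an index outside the support,
    so the minimum over the complement is genuine.\<close>
  have S: "?S \<noteq> UNIV"
    using assms(6,8) by (auto simp: sparse_vectors_def)
  have first: "J r = ?S \<and> (\<forall>k<r. J k \<subset> ?S)"
    if seq: "cmp_sequence A P ?y x js J" and less: "\<forall>k<r. ?less x J k" for x js J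
  proof -
    have J: "J k \<subseteq> ?S" "card (J k) = k" if "k \<le> r" for k
      using cmp_sequence_card_eq[OF seq P0 S, of k] less that r by auto
    have "J r = ?S" using J[of r] r by (intro card_subset_eq) auto
    moreover have "J k \<subset> ?S" if "k < r" for k using J[of k] that r by auto
    ultimately show ?thesis by blast
  qed
  have necessary: "?less x J k"
    if rec: "exact_support_recovery A P z" and seq: "cmp_sequence A P ?y x js J" and k: "k < r"
    for x js J k
  proof (rule ccontr)
    assume not_less: "\<not> ?less x J k"
    have small: "card (J i) < r" if "i \<le> k" for i
      using cmp_sequence_card_le[OF seq, of i] that k by simp
    have "?S - J k \<noteq> {}"
      using small[of k] r card_mono[of "J k" ?S] by auto
    from wrong_index_selectable[OF seq P0 this S not_less]
    obtain j where j: "j \<notin> ?S" "is_arg_min (g_star A P ?y (x k)) (\<lambda>j. True) j" .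
    from cmp_sequence_redirect[OF seq assms(4) j(2)]
    obtain x' js' J' where seq': "cmp_sequence A P ?y x' js' J'"
      and same: "\<And>i. i \<le> k \<Longrightarrow> J' i = J i" and j': "js' (Suc k) = j" by blast
    obtain s where s: "J' s = ?S" using rec seq' unfolding exact_support_recovery_def by blast
    show False
    \<comment> \<open>Up to time \<open>k\<close> the index set is too small to be the support;
      afterwards it contains the wrong index \<open>j\<close>.\<close>
    proof (cases "s \<le> k")
      case True
      then show False using s same small[of s] r by simp
    next
      case False
      then have "J' (Suc k) \<subseteq> ?S" using cmp_sequence_mono[OF seq', of "Suc k" s] s by simp
      then show False using cmp_sequence_step(2)[OF seq', of k] j' j(1) by simp
    qed
  qed
  show ?thesis
    unfolding f_star_eq_g_star
  proof (intro conjI iffI impI)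
    assume less: "\<forall>x js J. cmp_sequence A P ?y x js J \<longrightarrow> (\<forall>k<r. ?less x J k)"
    show "exact_support_recovery A P z"
      unfolding exact_support_recovery_def using first less by meson
  \<comment> \<open>Both remaining goals start from recovery: \<open>necessary\<close> yields the
    strict inequalities, and \<open>first\<close> turns them into the claim about step
    \<open>r\<close>.\<close>
  qed (use first necessary in meson)+
qed

end
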